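(* Let $H=\langle x,y \mid [x,[x,y]],[y,[x,y]]\rangle$ be the discrete Heisenberg group and let $A$ be a finite generating set for $H$. Then there exists $r\in\mathbb{N}$ such that, for every $h\in H$, the retreat depth of $h$ with respect to $A$ is at most $r$.
   Context: For a group $G$ with generating set $A$, $\|g\|_A$ denotes the length of a shortest word in the letters of $A\cup A^{-1}$ representing $g\in G$. $B_s(1)=\{g\in G : \|g\|_A\le s\}$ is the ball of radius $s$ about the identity (empty if $s<0$). Let $g\in G$ with $\|g\|_A=l$. The retreat depth of $g$ with respect to $A$ is the minimal integer $d\ge 0$ such that $g$ lies in an unbounded connected component of $G\setminus B_{l-d}(1)$, where connectedness refers to the subgraph of the Cayley graph of $G$ with respect to $A$ spanned by the vertices in $G\setminus B_{l-d}(1)$. *)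

theory Defs
  imports "HOL-Algebra.Generated_Groups" "HOL-Library.Extended_Nat"
begin

section \<open>Group presentations\<close>

text \<open>A letter \<open>(a, True)\<close> stands for the generator \<open>a\<close>, and \<open>(a, False)\<close> for its formal inverse.\<close>

type_synonym 'a gword = "('a \<times> bool) list"

definition inv_gword :: "'a gword \<Rightarrow> 'a gword" where
  "inv_gword w = rev (map (\<lambda>(a, b). (a, \<not> b)) w)"

definition comm_gword :: "'a gword \<Rightarrow> 'a gword \<Rightarrow> 'a gword" where
  "comm_gword u v = u @ v @ inv_gword u @ inv_gword v"

text \<open>The congruence on words generated by free cancellation and by the relators in \<open>R\<close>.\<close>

inductive_set pres_cong :: "'a gword set \<Rightarrow> ('a gword \<times> 'a gword) set"
  for R :: "'a gword set" where
  cancel: "([(a, b), (a, \<not> b)], []) \<in> pres_cong R"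
| relator: "r \<in> R \<Longrightarrow> (r, []) \<in> pres_cong R"
| refl: "(u, u) \<in> pres_cong R"
| sym: "(u, v) \<in> pres_cong R \<Longrightarrow> (v, u) \<in> pres_cong R"
| trans: "(u, v) \<in> pres_cong R \<Longrightarrow> (v, w) \<in> pres_cong R \<Longrightarrow> (u, w) \<in> pres_cong R"
| append: "(u, u') \<in> pres_cong R \<Longrightarrow> (v, v') \<in> pres_cong R \<Longrightarrow> (u @ v, u' @ v') \<in> pres_cong R"

text \<open>The group presented by all elements of the type \<open>'a\<close> as generators, subject to the relators
  in \<open>R\<close>.\<close>

definition presented_group :: "'a gword set \<Rightarrow> 'a gword set monoid" where
  "presented_group R =
    \<lparr>carrier = UNIV // pres_cong R,
     monoid.mult = (\<lambda>C D. \<Union>u\<in>C. \<Union>v\<in>D. pres_cong R `` {u @ v}),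
     one = pres_cong R `` {[]}\<rparr>"

lemma equiv_pres_cong: "equiv UNIV (pres_cong R)"
proof (rule equivI)
  show "pres_cong R \<subseteq> UNIV \<times> UNIV" by simp
  show "refl_on UNIV (pres_cong R)" by (rule refl_onI) (rule pres_cong.refl)
  show "Relation.sym (pres_cong R)" by (rule symI) (rule pres_cong.sym)
  show "Relation.trans (pres_cong R)" by (rule transI) (rule pres_cong.trans)
qed

lemma presented_group_mult:
  "(pres_cong R `` {u}) \<otimes>\<^bsub>presented_group R\<^esub> (pres_cong R `` {v}) = pres_cong R `` {u @ v}"
proof -
  have eq: "pres_cong R `` {u' @ v'} = pres_cong R `` {u @ v}"
    if "u' \<in> pres_cong R `` {u}" "v' \<in> pres_cong R `` {v}" for u' v'
  proof -
    have "(u @ v, u' @ v') \<in> pres_cong R"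
      using that by (intro pres_cong.append) simp_all
    from equiv_class_eq[OF equiv_pres_cong this] show ?thesis by (rule HOL.sym)
  qed
  have in_class: "w \<in> pres_cong R `` {w}" for w
    by (simp add: pres_cong.refl)
  have "(\<Union>u'\<in>pres_cong R `` {u}. \<Union>v'\<in>pres_cong R `` {v}. pres_cong R `` {u' @ v'})
      = pres_cong R `` {u @ v}" (is "?L = ?R")
  proof
    show "?L \<subseteq> ?R" by (intro UN_least equalityD1[OF eq])
    show "?R \<subseteq> ?L" using UN_I[OF in_class UN_I[OF in_class]] by (rule subsetI)
  qed
  then show ?thesis by (simp only: presented_group_def monoid.simps partial_object.simps)
qed

lemma inv_gword_cong: "(inv_gword w @ w, []) \<in> pres_cong R"
proof (induction w)
  case Nil
  show ?case by (simp add: inv_gword_def pres_cong.refl)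
next
  case (Cons l w)
  obtain a b where l: "l = (a, b)" by force
  have "([(a, \<not> b), (a, b)], []) \<in> pres_cong R"
    using pres_cong.cancel[of a "\<not> b" R] by simp
  from pres_cong.append[OF pres_cong.append[OF pres_cong.refl[of "inv_gword w"] this]
      pres_cong.refl[of w]]
  have "(inv_gword (l # w) @ (l # w), inv_gword w @ w) \<in> pres_cong R"
    by (simp add: inv_gword_def l)
  then show ?case using Cons.IH by (rule pres_cong.trans)
qed

lemma group_presented_group: "group (presented_group R)"
proof (rule groupI)
  let ?G = "presented_group R"
  have carr: "carrier ?G = range (\<lambda>u. pres_cong R `` {u})"
    by (auto simp: presented_group_def quotient_def)
  have one: "\<one>\<^bsub>?G\<^esub> = pres_cong R `` {[]}"
    by (simp add: presented_group_def)
  show "\<one>\<^bsub>?G\<^esub> \<in> carrier ?G" by (simp add: carr one)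
  show "C \<otimes>\<^bsub>?G\<^esub> D \<in> carrier ?G" if "C \<in> carrier ?G" "D \<in> carrier ?G" for C D
    using that by (auto simp: carr presented_group_mult)
  show "C \<otimes>\<^bsub>?G\<^esub> D \<otimes>\<^bsub>?G\<^esub> E = C \<otimes>\<^bsub>?G\<^esub> (D \<otimes>\<^bsub>?G\<^esub> E)"
    if "C \<in> carrier ?G" "D \<in> carrier ?G" "E \<in> carrier ?G" for C D E
    using that by (auto simp: carr presented_group_mult)
  show "\<one>\<^bsub>?G\<^esub> \<otimes>\<^bsub>?G\<^esub> C = C" if "C \<in> carrier ?G" for C
    using that by (auto simp: carr one presented_group_mult)
  show "\<exists>D\<in>carrier ?G. D \<otimes>\<^bsub>?G\<^esub> C = \<one>\<^bsub>?G\<^esub>" if C: "C \<in> carrier ?G" for C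
  proof -
    obtain w where w: "C = pres_cong R `` {w}" using C by (auto simp: carr)
    have "(pres_cong R `` {inv_gword w}) \<otimes>\<^bsub>?G\<^esub> C = \<one>\<^bsub>?G\<^esub>"
      unfolding w one presented_group_mult
      by (rule equiv_class_eq[OF equiv_pres_cong inv_gword_cong])
    then show ?thesis by (auto simp: carr)
  qed
qed

datatype heisenberg_gen = Gen_x | Gen_y

definition heisenberg :: "heisenberg_gen gword set monoid" where
  "heisenberg =
    (let x = [(Gen_x, True)]; y = [(Gen_y, True)]
     in presented_group {comm_gword x (comm_gword x y), comm_gword y (comm_gword x y)})"

section \<open>Word length, balls and Cayley graphs\<close>

definition letters :: "('a, 'b) monoid_scheme \<Rightarrow> 'a set \<Rightarrow> 'a set" where
  "letters G A = A \<union> m_inv G ` A"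

text \<open>Meaningful only if \<open>A\<close> generates \<open>G\<close> and \<open>g\<close> is in the carrier.\<close>

definition word_length :: "('a, 'b) monoid_scheme \<Rightarrow> 'a set \<Rightarrow> 'a \<Rightarrow> nat" where
  "word_length G A g =
    (LEAST n. \<exists>ws. set ws \<subseteq> letters G A \<and> foldr (\<otimes>\<^bsub>G\<^esub>) ws \<one>\<^bsub>G\<^esub> = g \<and> length ws = n)"

definition word_ball :: "('a, 'b) monoid_scheme \<Rightarrow> 'a set \<Rightarrow> int \<Rightarrow> 'a set" where
  "word_ball G A s = {g \<in> carrier G. int (word_length G A g) \<le> s}"

definition cayley_edges :: "('a, 'b) monoid_scheme \<Rightarrow> 'a set \<Rightarrow> ('a \<times> 'a) set" where
  "cayley_edges G A = {(g, g \<otimes>\<^bsub>G\<^esub> a) | g a. g \<in> carrier G \<and> a \<in> letters G A}"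

text \<open>Connected components of the subgraph of the Cayley graph spanned by the vertex set \<open>V\<close>;
  the edge relation is symmetric because \<open>letters G A\<close> is closed under inverses.\<close>

definition cayley_components :: "('a, 'b) monoid_scheme \<Rightarrow> 'a set \<Rightarrow> 'a set \<Rightarrow> 'a set set" where
  "cayley_components G A V = V // (cayley_edges G A \<inter> V \<times> V)\<^sup>*"

definition word_bounded :: "('a, 'b) monoid_scheme \<Rightarrow> 'a set \<Rightarrow> 'a set \<Rightarrow> bool" where
  "word_bounded G A C \<longleftrightarrow> (\<exists>s. C \<subseteq> word_ball G A s)"

text \<open>The infimum is the minimum whenever some \<open>d\<close> qualifies, as is the case for every element of
  an infinite finitely generated group; otherwise the retreat depth is \<open>\<infinity>\<close>.\<close>

definition retreat_depth :: "('a, 'b) monoid_scheme \<Rightarrow> 'a set \<Rightarrow> 'a \<Rightarrow> enat" where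
  "retreat_depth G A g =
    (INF d \<in> {d. \<exists>C \<in> cayley_components G A
                     (carrier G - word_ball G A (int (word_length G A g) - int d)).
                   g \<in> C \<and> \<not> word_bounded G A C}. enat d)"

end

theory Submission
  imports Defs "HOL-Library.Multiset"
begin

text \<open>The escape route from an element \<open>h\<close> is one of the two rays \<open>h z\<^sup>k\<close> and \<open>h z\<^bsup>-k\<^esup>\<close>,
  \<open>k \<ge> 0\<close>, where \<open>z = [x, y]\<close> generates the centre. It suffices that word length drops along one
  of them by at most a constant independent of \<open>h\<close>: consecutive points of a ray are joined by
  paths of bounded length, and the rays leave every ball
  (\<open>retreat_depth_le_along_powers\<close>). If both rays failed, there would be \<open>g\<^sub>1 = h z\<^sup>k\<close> and
  \<open>g\<^sub>2 = h z\<^bsup>-j\<^esup>\<close>, both much shorter than \<open>h\<close>, so the point is that word length is quasiconvex,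
  up to an additive constant, along each coset of the centre
  (\<open>word_length_almost_quasiconvex\<close>).

  To see this, use coordinates \<open>(a, b, s)\<close> in which
  \<open>s (g h) = s g + s h + a g * b h - b g * a h\<close>. The \<open>s\<close>-coordinate of a word is then the sum of
  the \<open>s\<close>-coordinates of its letters plus twice the signed area swept out by its projection to
  the \<open>(a, b)\<close>-plane. Only the area depends on the order of the letters. Reversing a word
  negates the area, and a word can be reversed by transpositions of neighbouring letters, each of
  which changes the area by a bounded amount; so the permutations of a word attain, up to a
  bounded error, every area between \<open>-\<alpha>\<close> and \<open>\<alpha>\<close>, where \<open>\<alpha>\<close> is the absolute
  area of the word itself
  without its sign
  (\<open>permute_to_area\<close>).

  Let \<open>w\<^sub>1\<close>, \<open>w\<^sub>2\<close> be geodesic words for \<open>g\<^sub>1\<close>, \<open>g\<^sub>2\<close>. If the \<open>s\<close>-coordinate of \<open>h\<close> lies in the range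
  of the permutations of one of them, then a permutation of that word ends at a bounded distance
  from \<open>h\<close> on the coset of the centre. Otherwise \<open>s h\<close> lies between the two letter sums of
  \<open>s\<close>. Then the weighted average of the two multisets of letters whose letter sum is exactly
  that of \<open>h\<close>, rounded down to integer multiplicities, has at most \<open>max |w\<^sub>1| |w\<^sub>2|\<close> letters and
  almost the right sums (\<open>rounded_mixture\<close>). Boundedly many further letters correct the
  projection, and arranging the letters so that the area is almost zero gives a word that ends
  at a bounded distance from \<open>h\<close>.\<close>

section \<open>Words in a finitely generated group\<close>

locale fin_gen_group = group G for G (structure) +
  fixes A
  assumes fin: "finite A" and sub: "A \<subseteq> carrier G" and gen: "generate G A = carrier G"
begin

abbreviation wval where "wval ws \<equiv> foldr (\<otimes>) ws \<one>"

abbreviation wl where "wl \<equiv> word_length G A"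

lemma finite_letters: "finite (letters G A)"
  using fin by (simp add: letters_def)

lemma letters_closed: "u \<in> letters G A \<Longrightarrow> u \<in> carrier G"
  using sub by (auto simp: letters_def)

lemma inv_letters: "u \<in> letters G A \<Longrightarrow> inv u \<in> letters G A"
  using sub by (auto simp: letters_def)

lemma wval_closed: "set ws \<subseteq> letters G A \<Longrightarrow> wval ws \<in> carrier G"
  by (induction ws) (auto simp: letters_closed)

lemma wval_append:
  "set us \<subseteq> letters G A \<Longrightarrow> set vs \<subseteq> letters G A \<Longrightarrow> wval (us @ vs) = wval us \<otimes> wval vs"
proof (induction us)
  case (Cons u us)
  then show ?case
    using wval_closed[of us] wval_closed[of vs] by (auto simp: letters_closed m_assoc)
qed (simp add: wval_closed)

lemma exists_word:
  assumes "g \<in> carrier G"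
  shows "\<exists>ws. set ws \<subseteq> letters G A \<and> wval ws = g"
proof -
  have "g \<in> generate G A" using assms gen by simp
  then show ?thesis
  proof induction
    case one
    show ?case by (rule exI[of _ "[]"]) simp
  next
    case (incl h)
    then show ?case using sub by (intro exI[of _ "[h]"]) (auto simp: letters_def)
  next
    case (inv h)
    then show ?case using sub by (intro exI[of _ "[inv h]"]) (auto simp: letters_def)
  next
    case (eng h1 h2)
    then obtain us vs where "set us \<subseteq> letters G A" "wval us = h1"
      "set vs \<subseteq> letters G A" "wval vs = h2" by blast
    then show ?case using wval_append by (intro exI[of _ "us @ vs"]) auto
  qed
qed

lemma word_length_le: "set ws \<subseteq> letters G A \<Longrightarrow> wl (wval ws) \<le> length ws"
  unfolding word_length_def by (rule Least_le) blast

lemma geodesic: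
  assumes "g \<in> carrier G"
  obtains ws where "set ws \<subseteq> letters G A" "wval ws = g" "length ws = wl g"
proof -
  have "\<exists>ws. set ws \<subseteq> letters G A \<and> wval ws = g \<and> length ws = wl g"
    unfolding word_length_def by (rule LeastI_ex) (use exists_word[OF assms] in blast)
  then show ?thesis using that by blast
qed

lemma word_length_mult_le:
  assumes "g \<in> carrier G" "h \<in> carrier G"
  shows "wl (g \<otimes> h) \<le> wl g + wl h"
proof -
  obtain us where us: "set us \<subseteq> letters G A" "wval us = g" "length us = wl g"
    using geodesic[OF assms(1)] .
  obtain vs where vs: "set vs \<subseteq> letters G A" "wval vs = h" "length vs = wl h"
    using geodesic[OF assms(2)] .
  show ?thesis
    using word_length_le[of "us @ vs"] us vs wval_append[of us vs] by simp
qed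

lemma word_length_letter: "u \<in> letters G A \<Longrightarrow> wl u \<le> 1"
  using word_length_le[of "[u]"] by (simp add: letters_closed)

lemma finite_word_ball: "finite (word_ball G A s)"
proof -
  have "word_ball G A s \<subseteq> wval ` {ws. set ws \<subseteq> letters G A \<and> length ws \<le> nat s}"
  proof
    fix g assume g: "g \<in> word_ball G A s"
    then obtain ws where "set ws \<subseteq> letters G A" "wval ws = g" "length ws = wl g"
      using geodesic by (auto simp: word_ball_def)
    then show "g \<in> wval ` {ws. set ws \<subseteq> letters G A \<and> length ws \<le> nat s}"
      using g by (auto simp: word_ball_def)
  qed
  then show ?thesis
    using finite_lists_length_le[OF finite_letters] finite_subset by blast
qed

text \<open>A letter changes the length by at most one, so a path of \<open>n\<close> letters that starts at length
  greater than \<open>t + n\<close> cannot enter the ball of radius \<open>t\<close>.\<close>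

lemma path_outside_ball:
  assumes "set us \<subseteq> letters G A" "g \<in> carrier G" "t + int (length us) < int (wl g)"
  shows "(g, g \<otimes> wval us) \<in> (cayley_edges G A \<inter>
    (carrier G - word_ball G A t) \<times> (carrier G - word_ball G A t))\<^sup>*"
  using assms
proof (induction us arbitrary: g)
  case (Cons u us)
  then have u: "u \<in> letters G A" "u \<in> carrier G" and us: "set us \<subseteq> letters G A"
    by (auto simp: letters_closed)
  have "wl g = wl (g \<otimes> u \<otimes> inv u)"
    using Cons.prems u by (simp add: m_assoc)
  also have "\<dots> \<le> wl (g \<otimes> u) + wl (inv u)"
    using Cons.prems u by (intro word_length_mult_le) auto
  finally have "wl g \<le> wl (g \<otimes> u) + 1"
    using word_length_letter[OF inv_letters[OF u(1)]] by simp
  then have t: "t + int (length us) < int (wl (g \<otimes> u))"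
    using Cons.prems(3) by simp
  have "(g, g \<otimes> u) \<in> cayley_edges G A \<inter>
      (carrier G - word_ball G A t) \<times> (carrier G - word_ball G A t)"
    using Cons.prems u t by (auto simp: cayley_edges_def word_ball_def)
  moreover have "g \<otimes> wval (u # us) = (g \<otimes> u) \<otimes> wval us"
    using Cons.prems u wval_closed[OF us] by (simp add: m_assoc)
  ultimately show ?case
    using Cons.IH[OF us _ t] Cons.prems u
    by (metis (no_types, lifting) converse_rtrancl_into_rtrancl m_closed)
qed simp

text \<open>Balls are finite, so a ray \<open>h z\<^sup>k\<close> of pairwise distinct points that stays outside a ball lies in
  an unbounded component of its complement. The summand \<open>wl z\<close> in the bound allows for the
  vertices between \<open>h z\<^sup>k\<close> and \<open>h z\<^bsup>k+1\<^esup>\<close>, and the summand \<open>1\<close> for the fact that a ball contains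
  its boundary sphere.\<close>

lemma retreat_depth_le_along_powers:
  assumes h: "h \<in> carrier G" and z: "z \<in> carrier G"
    and inj: "inj (\<lambda>k::nat. z [^] k)"
    and far: "\<And>k::nat. wl h \<le> wl (h \<otimes> z [^] k) + C"
  shows "retreat_depth G A h \<le> enat (C + wl z + 1)"
proof -
  define t where "t = int (wl h) - int (C + wl z + 1)"
  define V where "V = carrier G - word_ball G A t"
  define E where "E = (cayley_edges G A \<inter> V \<times> V)\<^sup>*"
  obtain us where us: "set us \<subseteq> letters G A" "wval us = z" "length us = wl z"
    using geodesic[OF z] .
  have reach: "(h, h \<otimes> z [^] k) \<in> E" for k :: nat
  proof (induction k)
    case (Suc k)
    have "(h \<otimes> z [^] k, h \<otimes> z [^] k \<otimes> wval us) \<in> E"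
      unfolding E_def V_def
      by (rule path_outside_ball) (use us h z far[of k] in \<open>auto simp: t_def\<close>)
    then show ?case
      using Suc us h z unfolding E_def by (auto simp: m_assoc intro: rtrancl_trans)
  qed (use h in \<open>simp add: E_def\<close>)
  have "h \<in> V"
    using h by (simp add: V_def word_ball_def t_def)
  then have "E `` {h} \<in> cayley_components G A V"
    unfolding cayley_components_def E_def by (rule quotientI)
  moreover have "h \<in> E `` {h}"
    by (simp add: E_def)
  moreover have "\<not> word_bounded G A (E `` {h})"
  proof
    assume "word_bounded G A (E `` {h})"
    then have "finite (range (\<lambda>k::nat. h \<otimes> z [^] k))"
      unfolding word_bounded_def using reach finite_word_ball
      by (metis (no_types, lifting) Image_singleton_iff finite_subset image_subset_iff subset_trans)
    moreover have "inj (\<lambda>k::nat. h \<otimes> z [^] k)"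
      using inj h z by (auto simp: inj_def)
    ultimately show False
      using finite_imageD infinite_UNIV_nat by blast
  qed
  ultimately show ?thesis
    unfolding retreat_depth_def V_def t_def by (intro INF_lower) blast
qed

end

section \<open>The area of a sequence of plane vectors\<close>

text \<open>For vectors \<open>(p u, q u)\<close> this is twice the signed area between the polygonal path with these
  steps and its chord.\<close>

fun area :: "('a \<Rightarrow> int) \<Rightarrow> ('a \<Rightarrow> int) \<Rightarrow> 'a list \<Rightarrow> int" where
  "area p q [] = 0"
| "area p q (u # us) = area p q us + p u * sum_list (map q us) - q u * sum_list (map p us)"

lemma area_append:
  "area p q (us @ vs) = area p q us + area p q vs
    + sum_list (map p us) * sum_list (map q vs) - sum_list (map q us) * sum_list (map p vs)"
  by (induction us) (simp_all add: algebra_simps)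

text \<open>Rotating the path by half a turn about the midpoint of its chord gives the path of the reversed
  list, traversed backwards.\<close>

lemma area_rev: "area p q (rev us) = - area p q us"
  by (induction us) (simp_all add: area_append rev_map[symmetric] algebra_simps)

inductive adj_swap :: "'a list \<Rightarrow> 'a list \<Rightarrow> bool" where
  "adj_swap (us @ x # y # vs) (us @ y # x # vs)"

lemma adj_swap_append: "adj_swap xs ys \<Longrightarrow> adj_swap (us @ xs @ vs) (us @ ys @ vs)"
proof (induction rule: adj_swap.induct)
  case (1 as x y bs)
  then show ?case using adj_swap.intros[of "us @ as" x y "bs @ vs"] by simp
qed

lemma adj_swaps_append: "adj_swap\<^sup>*\<^sup>* xs ys \<Longrightarrow> adj_swap\<^sup>*\<^sup>* (us @ xs @ vs) (us @ ys @ vs)"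
  by (induction rule: rtranclp_induct) (auto intro: adj_swap_append rtranclp.rtrancl_into_rtrancl)

lemma adj_swaps_move_to_end: "adj_swap\<^sup>*\<^sup>* (x # xs) (xs @ [x])"
proof (induction xs)
  case (Cons y ys)
  have "adj_swap (x # y # ys) (y # x # ys)"
    using adj_swap.intros[of "[]"] by simp
  then show ?case
    using adj_swaps_append[OF Cons, of "[y]" "[]"] by (simp add: converse_rtranclp_into_rtranclp)
qed simp

lemma adj_swaps_rev: "adj_swap\<^sup>*\<^sup>* xs (rev xs)"
proof (induction xs)
  case (Cons x xs)
  have "adj_swap\<^sup>*\<^sup>* (x # xs) (x # rev xs)"
    using adj_swaps_append[OF Cons, of "[x]" "[]"] by simp
  then show ?case
    using adj_swaps_move_to_end[of x "rev xs"] by simp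
qed simp

lemma mset_adj_swaps: "adj_swap\<^sup>*\<^sup>* xs ys \<Longrightarrow> mset ys = mset xs"
proof (induction rule: rtranclp_induct)
  case (step us vs)
  from step(2) have "mset vs = mset us"
    by cases (simp add: add_mset_commute)
  then show ?case using step by simp
qed simp

text \<open>Transposing two neighbouring steps moves the path across one parallelogram.\<close>

lemma area_adj_swap:
  assumes "adj_swap xs ys" "set xs \<subseteq> L"
    and "\<And>u v. u \<in> L \<Longrightarrow> v \<in> L \<Longrightarrow> \<bar>p u * q v - q u * p v\<bar> \<le> K"
  shows "\<bar>area p q ys - area p q xs\<bar> \<le> 2 * K"
  using assms(1,2)
proof cases
  case (1 us x y vs)
  have "area p q xs - area p q ys = 2 * (p x * q y - q x * p y)"
    unfolding 1 by (simp add: area_append algebra_simps)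
  then show ?thesis
    using assms(2) assms(3)[of x y] 1 by auto
qed

lemma discrete_ivt:
  fixes f :: "'a \<Rightarrow> int"
  assumes "R\<^sup>*\<^sup>* x y" and "\<And>u v. R\<^sup>*\<^sup>* x u \<Longrightarrow> R u v \<Longrightarrow> \<bar>f v - f u\<bar> \<le> K"
    and "f x \<le> t" "t \<le> f y" "0 \<le> K"
  shows "\<exists>u. R\<^sup>*\<^sup>* x u \<and> \<bar>f u - t\<bar> \<le> K"
  using assms(1,4)
proof (induction rule: rtranclp_induct)
  case base
  then show ?case using assms(3,5) by (intro exI[of _ x]) auto
next
  case (step u v)
  show ?case
  proof (cases "t \<le> f u")
    case False
    then show ?thesis
      using assms(2)[OF step(1,2)] step by (intro exI[of _ v]) auto
  qed (use step in blast)
qed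

text \<open>The reversed list has the opposite area, and the transpositions that lead to it change the area
  by at most \<open>2 * K\<close> at a time, so no value in between is missed by more than that.\<close>

lemma permute_to_area:
  assumes L: "set xs \<subseteq> L"
    and K: "\<And>u v. u \<in> L \<Longrightarrow> v \<in> L \<Longrightarrow> \<bar>p u * q v - q u * p v\<bar> \<le> K" "0 \<le> K"
    and t: "\<bar>t\<bar> \<le> \<bar>area p q xs\<bar>"
  shows "\<exists>ys. mset ys = mset xs \<and> \<bar>area p q ys - t\<bar> \<le> 2 * K"
proof -
  have *: "\<exists>ys. mset ys = mset zs \<and> \<bar>area p q ys - t\<bar> \<le> 2 * K"
    if zs: "mset zs = mset xs" "area p q zs \<le> t" "t \<le> - area p q zs" for zs
  proof -
    have "\<exists>ys. adj_swap\<^sup>*\<^sup>* zs ys \<and> \<bar>area p q ys - t\<bar> \<le> 2 * K"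
    proof (rule discrete_ivt[OF adj_swaps_rev])
      fix us vs assume "adj_swap\<^sup>*\<^sup>* zs us" "adj_swap us vs"
      then show "\<bar>area p q vs - area p q us\<bar> \<le> 2 * K"
        using L zs(1) mset_adj_swaps[of zs us]
        by (intro area_adj_swap[of us vs L p q K] K(1)) (auto dest: mset_eq_setD)
    qed (use zs K(2) in \<open>auto simp: area_rev\<close>)
    then show ?thesis
      using mset_adj_swaps zs(1) by metis
  qed
  show ?thesis
  proof (cases "area p q xs \<le> 0")
    case True
    then show ?thesis using t by (intro *[of xs]) auto
  next
    case False
    then have "area p q (rev xs) \<le> t" "t \<le> - area p q (rev xs)"
      using t by (auto simp: area_rev)
    then show ?thesis using *[of "rev xs"] by simp
  qed
qed

section \<open>Averaging multisets of letters\<close>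

lemma sum_list_map_count:
  fixes f :: "'a \<Rightarrow> int"
  assumes "finite L" "set w \<subseteq> L"
  shows "sum_list (map f w) = (\<Sum>u\<in>L. int (count_list w u) * f u)"
  using assms(2)
proof (induction w)
  case (Cons x w)
  have "(\<Sum>u\<in>L. int (count_list (x # w) u) * f u)
      = (\<Sum>u\<in>L. (if u = x then f u else 0) + int (count_list w u) * f u)"
    by (rule sum.cong) (auto simp: algebra_simps)
  then show ?case
    using Cons assms(1) by (simp add: sum.distrib)
qed simp

lemma sum_list_map_replicates:
  fixes f :: "'a \<Rightarrow> int"
  shows "sum_list (map f (concat (map (\<lambda>u. replicate (k u) u) us)))
    = sum_list (map (\<lambda>u. int (k u) * f u) us)"
  by (induction us) (simp_all add: sum_list_replicate)

text \<open>Read \<open>w1\<close> and \<open>w2\<close> as multiplicity vectors on the alphabet \<open>L\<close>. Rounding their average with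
  weights \<open>p\<close> and \<open>r\<close> down in each coordinate cannot increase the length, and it changes any sum
  over letters by less than one copy of each letter. The inequality is stated after
  multiplication by \<open>p + r\<close> to stay within the integers.\<close>

lemma rounded_mixture:
  fixes p r :: nat
  assumes L: "finite L" "set w1 \<subseteq> L" "set w2 \<subseteq> L" and pos: "0 < p + r"
    and n: "length w1 \<le> n" "length w2 \<le> n"
  shows "\<exists>w. set w \<subseteq> L \<and> length w \<le> n \<and>
    (\<forall>f. \<bar>int p * sum_list (map f w1) + int r * sum_list (map f w2)
        - int (p + r) * sum_list (map f w)\<bar> \<le> int (p + r) * (\<Sum>u\<in>L. \<bar>f u\<bar>))"
proof -
  define m where "m u = p * count_list w1 u + r * count_list w2 u" for u
  obtain us where us: "set us = L" "distinct us"
    using finite_distinct_list[OF L(1)] by blast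
  define w where "w = concat (map (\<lambda>u. replicate (m u div (p + r)) u) us)"
  have sum_w: "sum_list (map f w) = (\<Sum>u\<in>L. int (m u div (p + r)) * f u)" for f
    unfolding w_def sum_list_map_replicates
    by (metis us sum_list_distinct_conv_sum_set)
  have split: "int p * sum_list (map f w1) + int r * sum_list (map f w2)
      = int (p + r) * sum_list (map f w) + (\<Sum>u\<in>L. int (m u mod (p + r)) * f u)" for f
  proof -
    have "int p * sum_list (map f w1) + int r * sum_list (map f w2) = (\<Sum>u\<in>L. int (m u) * f u)"
      unfolding sum_list_map_count[OF L(1,2)] sum_list_map_count[OF L(1,3)]
      by (simp add: m_def sum_distrib_left sum.distrib algebra_simps)
    also have "\<dots> = (\<Sum>u\<in>L. int (p + r) * (int (m u div (p + r)) * f u)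
        + int (m u mod (p + r)) * f u)"
    proof (rule sum.cong)
      fix u
      have "int (m u) = int (p + r) * int (m u div (p + r)) + int (m u mod (p + r))"
        by (metis mult_div_mod_eq of_nat_add of_nat_mult)
      then show "int (m u) * f u = int (p + r) * (int (m u div (p + r)) * f u)
          + int (m u mod (p + r)) * f u"
        by (simp only: algebra_simps)
    qed simp
    finally show ?thesis
      by (simp add: sum_w sum.distrib sum_distrib_left)
  qed
  show ?thesis
  proof (intro exI[of _ w] conjI allI)
    show "set w \<subseteq> L" using us by (auto simp: w_def)
    have "int (p + r) * int (length w) \<le> int p * int (length w1) + int r * int (length w2)"
      using split[of "\<lambda>_. 1"] sum_nonneg[of L "\<lambda>u. int (m u mod (p + r))"]
      by (simp add: sum_list_triv)
    also have "\<dots> \<le> int p * int n + int r * int n"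
      using n by (intro add_mono mult_left_mono) auto
    finally have "int (p + r) * int (length w) \<le> int (p + r) * int n"
      by (simp add: algebra_simps)
    then show "length w \<le> n"
      using pos by (metis mult_le_cancel_left_pos of_nat_0_less_iff of_nat_le_iff)
    fix f :: "'a \<Rightarrow> int"
    have "\<bar>\<Sum>u\<in>L. int (m u mod (p + r)) * f u\<bar> \<le> (\<Sum>u\<in>L. \<bar>int (m u mod (p + r)) * f u\<bar>)"
      by (rule sum_abs)
    also have "\<dots> \<le> (\<Sum>u\<in>L. int (p + r) * \<bar>f u\<bar>)"
    proof (rule sum_mono)
      fix u
      have "m u mod (p + r) \<le> p + r"
        using pos by (simp add: less_imp_le)
      then show "\<bar>int (m u mod (p + r)) * f u\<bar> \<le> int (p + r) * \<bar>f u\<bar>"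
        unfolding abs_mult by (intro mult_right_mono) auto
    qed
    finally show "\<bar>int p * sum_list (map f w1) + int r * sum_list (map f w2)
        - int (p + r) * sum_list (map f w)\<bar> \<le> int (p + r) * (\<Sum>u\<in>L. \<bar>f u\<bar>)"
      using split[of f] by (simp add: sum_distrib_left)
  qed
qed

section \<open>Groups with Heisenberg coordinates\<close>

text \<open>Here \<open>(a, b)\<close> is a homomorphism to the plane, and the cocycle of \<open>s\<close> is the determinant. In the
  usual matrix coordinates \<open>(a, b, c)\<close> with product \<open>(a + a', b + b', c + c' + a b')\<close> one has
  \<open>s = 2 c - a b\<close>. This antisymmetric choice makes \<open>s\<close> odd under inversion and relates it to the area
  between a path and its chord.\<close>

locale symplectic_coordinates = group G for G (structure) +
  fixes a b s :: "'a \<Rightarrow> int"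
  assumes a_mult: "g \<in> carrier G \<Longrightarrow> h \<in> carrier G \<Longrightarrow> a (g \<otimes> h) = a g + a h"
    and b_mult: "g \<in> carrier G \<Longrightarrow> h \<in> carrier G \<Longrightarrow> b (g \<otimes> h) = b g + b h"
    and s_mult: "g \<in> carrier G \<Longrightarrow> h \<in> carrier G \<Longrightarrow> s (g \<otimes> h) = s g + s h + a g * b h - b g * a h"
begin

lemma coords_one: "a \<one> = 0" "b \<one> = 0" "s \<one> = 0"
  using a_mult[of \<one> \<one>] b_mult[of \<one> \<one>] s_mult[of \<one> \<one>] by simp_all

lemma coords_inv:
  assumes "g \<in> carrier G"
  shows "a (inv g) = - a g" "b (inv g) = - b g" "s (inv g) = - s g"
proof -
  show "a (inv g) = - a g" and b: "b (inv g) = - b g"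
    using assms a_mult[of "inv g" g] b_mult[of "inv g" g] coords_one by simp_all
  then show "s (inv g) = - s g"
    using assms s_mult[of "inv g" g] coords_one by simp
qed

lemma coords_nat_pow:
  assumes "g \<in> carrier G"
  shows "a (g [^] (k::nat)) = int k * a g" "b (g [^] k) = int k * b g" "s (g [^] k) = int k * s g"
proof -
  have "a (g [^] k) = int k * a g \<and> b (g [^] k) = int k * b g \<and> s (g [^] k) = int k * s g"
    by (induction k) (simp_all add: assms coords_one a_mult b_mult s_mult algebra_simps)
  then show "a (g [^] k) = int k * a g" "b (g [^] k) = int k * b g" "s (g [^] k) = int k * s g"
    by auto
qed

lemma coords_int_pow:
  assumes "g \<in> carrier G"
  shows "a (g [^] (i::int)) = i * a g" "b (g [^] i) = i * b g" "s (g [^] i) = i * s g"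
proof -
  have "a (g [^] i) = i * a g \<and> b (g [^] i) = i * b g \<and> s (g [^] i) = i * s g"
  proof (cases i rule: int_cases2)
    case (nonneg n)
    then show ?thesis using coords_nat_pow[OF assms] by (simp add: int_pow_int)
  next
    case (nonpos n)
    then show ?thesis
      using coords_nat_pow[OF assms] coords_inv[of "g [^] n"] assms by (simp add: int_pow_neg_int)
  qed
  then show "a (g [^] i) = i * a g" "b (g [^] i) = i * b g" "s (g [^] i) = i * s g"
    by auto
qed

end

locale fin_gen_heisenberg = symplectic_coordinates G a b s + fin_gen_group G A
  for G (structure) and a b s and A +
  assumes coords_inj:
      "g \<in> carrier G \<Longrightarrow> h \<in> carrier G \<Longrightarrow> a g = a h \<Longrightarrow> b g = b h \<Longrightarrow> s g = s h \<Longrightarrow> g = h"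
    and plane_surj: "\<exists>g\<in>carrier G. a g = i \<and> b g = j"
begin

lemma coords_wval:
  assumes "set ws \<subseteq> letters G A"
  shows "a (wval ws) = sum_list (map a ws)" "b (wval ws) = sum_list (map b ws)"
    "s (wval ws) = sum_list (map s ws) + area a b ws"
proof -
  have "a (wval ws) = sum_list (map a ws) \<and> b (wval ws) = sum_list (map b ws)
    \<and> s (wval ws) = sum_list (map s ws) + area a b ws"
    using assms
    by (induction ws) (simp_all add: coords_one a_mult b_mult s_mult wval_closed letters_closed)
  then show "a (wval ws) = sum_list (map a ws)" "b (wval ws) = sum_list (map b ws)"
    "s (wval ws) = sum_list (map s ws) + area a b ws"
    by auto
qed

text \<open>Such \<open>g\<close> and \<open>h\<close> differ by an element with coordinates \<open>(0, 0, s h - s g)\<close>, and there are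
  only finitely many of these.\<close>

lemma word_length_bounded_on_fibres:
  "\<exists>B. \<forall>g\<in>carrier G. \<forall>h\<in>carrier G. a h = a g \<and> b h = b g \<and> \<bar>s h - s g\<bar> \<le> N
    \<longrightarrow> wl h \<le> wl g + B"
proof -
  define F where "F = {g \<in> carrier G. a g = 0 \<and> b g = 0 \<and> \<bar>s g\<bar> \<le> N}"
  have "inj_on s F"
    by (intro inj_onI coords_inj) (simp_all add: F_def)
  moreover have "s ` F \<subseteq> {-N..N}"
    by (auto simp: F_def)
  ultimately have "finite F"
    using finite_imageD finite_subset[OF _ finite_atLeastAtMost_int] by metis
  then have B: "wl g \<le> Max (wl ` F)" if "g \<in> F" for g
    using that by (intro Max_ge) auto
  show ?thesis
  proof (intro exI ballI impI)
    fix g h assume "g \<in> carrier G" "h \<in> carrier G" "a h = a g \<and> b h = b g \<and> \<bar>s h - s g\<bar> \<le> N"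
    then have gh: "g \<in> carrier G" "h \<in> carrier G" "a h = a g" "b h = b g" "\<bar>s h - s g\<bar> \<le> N"
      by auto
    then have "inv g \<otimes> h \<in> F"
      by (simp add: F_def a_mult b_mult s_mult coords_inv)
    moreover have "wl h \<le> wl g + wl (inv g \<otimes> h)"
      using word_length_mult_le[of g "inv g \<otimes> h"] gh by (simp add: m_assoc[symmetric])
    ultimately show "wl h \<le> wl g + Max (wl ` F)"
      using B by force
  qed
qed

text \<open>Errors in the plane projection have to be corrected before the letters are arranged, because
  appending a letter \<open>u\<close> afterwards changes \<open>s\<close> by an amount that can grow with the length of the word.
  What matters about a correction word is therefore only its letter sums, which are bounded here.\<close>

lemma plane_correction_words:
  "\<exists>n S. \<forall>i j. \<bar>i\<bar> \<le> E \<longrightarrow> \<bar>j\<bar> \<le> E \<longrightarrow> (\<exists>c. set c \<subseteq> letters G A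
    \<and> sum_list (map a c) = i \<and> sum_list (map b c) = j \<and> length c \<le> n \<and> \<bar>sum_list (map s c)\<bar> \<le> S)"
proof -
  have "\<forall>x. \<exists>c. set c \<subseteq> letters G A \<and> sum_list (map a c) = fst x \<and> sum_list (map b c) = snd x"
  proof
    fix x :: "int \<times> int"
    obtain g where g: "g \<in> carrier G" "a g = fst x" "b g = snd x"
      using plane_surj by blast
    then obtain c where "set c \<subseteq> letters G A" "wval c = g"
      using exists_word by blast
    then show "\<exists>c. set c \<subseteq> letters G A \<and> sum_list (map a c) = fst x \<and> sum_list (map b c) = snd x"
      using g coords_wval[of c] by auto
  qed
  from choice[OF this] obtain c where c: "\<forall>x. set (c x) \<subseteq> letters G A
      \<and> sum_list (map a (c x)) = fst x \<and> sum_list (map b (c x)) = snd x"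
    by blast
  define Q where "Q = {-E..E} \<times> {-E..E}"
  define n where "n = (\<Sum>x\<in>Q. length (c x))"
  define S where "S = (\<Sum>x\<in>Q. \<bar>sum_list (map s (c x))\<bar>)"
  have fin: "finite Q" by (simp add: Q_def)
  show ?thesis
  proof (intro exI[of _ n] exI[of _ S] allI impI)
    fix i j :: int assume "\<bar>i\<bar> \<le> E" "\<bar>j\<bar> \<le> E"
    then have ij: "(i, j) \<in> Q" by (auto simp: Q_def)
    have "length (c (i, j)) \<le> n"
      unfolding n_def by (rule member_le_sum[OF ij _ fin]) simp
    moreover have "\<bar>sum_list (map s (c (i, j)))\<bar> \<le> S"
      unfolding S_def by (rule member_le_sum[OF ij _ fin]) simp
    ultimately show "\<exists>d. set d \<subseteq> letters G A \<and> sum_list (map a d) = i \<and> sum_list (map b d) = j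
        \<and> length d \<le> n \<and> \<bar>sum_list (map s d)\<bar> \<le> S"
      using c[rule_format, of "(i, j)"] by (intro exI[of _ "c (i, j)"]) simp
  qed
qed

lemma sum_list_map_mset_eq:
  assumes "mset ws' = mset ws"
  shows "sum_list (map (f :: 'a \<Rightarrow> int) ws') = sum_list (map f ws)"
proof -
  have "mset (map f ws') = mset (map f ws)"
    using assms by simp
  from arg_cong[OF this, of sum_mset] show ?thesis
    by (simp only: sum_mset_sum_list)
qed

text \<open>Three points \<open>g2\<close>, \<open>h\<close>, \<open>g1\<close> over the same point of the plane, in this vertical order:
  geodesic words for \<open>g1\<close> and \<open>g2\<close> are rearranged or averaged into a word that ends near \<open>h\<close>.\<close>

lemma word_length_almost_quasiconvex:
  "\<exists>C. \<forall>h\<in>carrier G. \<forall>g1\<in>carrier G. \<forall>g2\<in>carrier G. a g1 = a h \<and> a g2 = a h \<and> b g1 = b h \<and> b g2 = b h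
      \<and> s g2 \<le> s h \<and> s h \<le> s g1 \<longrightarrow> wl h \<le> max (wl g1) (wl g2) + C"
proof -
  define L where "L = letters G A"
  have finL: "finite L" by (simp add: L_def finite_letters)
  define K where "K = (\<Sum>(u, v)\<in>L \<times> L. \<bar>a u * b v - b u * a v\<bar>)"
  have K0: "0 \<le> K" unfolding K_def by (rule sum_nonneg) auto
  have K: "\<bar>a u * b v - b u * a v\<bar> \<le> K" if "u \<in> L" "v \<in> L" for u v
  proof -
    have "(case (u, v) of (u, v) \<Rightarrow> \<bar>a u * b v - b u * a v\<bar>) \<le> K"
      unfolding K_def by (rule member_le_sum) (use that finL in auto)
    then show ?thesis by simp
  qed
  define E where "E = (\<Sum>u\<in>L. \<bar>a u\<bar>) + (\<Sum>u\<in>L. \<bar>b u\<bar>) + (\<Sum>u\<in>L. \<bar>s u\<bar>)"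
  have nonneg: "0 \<le> (\<Sum>u\<in>L. \<bar>f u\<bar>)" for f :: "'a \<Rightarrow> int"
    by (rule sum_nonneg) simp
  have E: "(\<Sum>u\<in>L. \<bar>a u\<bar>) \<le> E" "(\<Sum>u\<in>L. \<bar>b u\<bar>) \<le> E" "(\<Sum>u\<in>L. \<bar>s u\<bar>) \<le> E"
    using nonneg[of a] nonneg[of b] nonneg[of s] by (simp_all add: E_def)
  obtain m S where corr: "\<forall>i j. \<bar>i\<bar> \<le> E \<longrightarrow> \<bar>j\<bar> \<le> E \<longrightarrow> (\<exists>c. set c \<subseteq> L
    \<and> sum_list (map a c) = i \<and> sum_list (map b c) = j \<and> length c \<le> m \<and> \<bar>sum_list (map s c)\<bar> \<le> S)"
    using plane_correction_words[of E, folded L_def] by (elim exE) (rule that)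
  define N where "N = 2 * K + E + S"
  have E0: "0 \<le> E" using E(1) nonneg[of a] by linarith
  obtain c where "\<bar>sum_list (map s c)\<bar> \<le> S"
    using corr[rule_format, of 0 0] E0 by auto
  then have S0: "0 \<le> S" by linarith
  have N: "2 * K \<le> N" using E0 S0 by (simp add: N_def)
  obtain B where B: "\<forall>g\<in>carrier G. \<forall>h\<in>carrier G. a h = a g \<and> b h = b g \<and> \<bar>s h - s g\<bar> \<le> N
    \<longrightarrow> wl h \<le> wl g + B"
    using word_length_bounded_on_fibres[of N] by (elim exE) (rule that)
  have near: "wl h \<le> length w + B"
    if "h \<in> carrier G" "set w \<subseteq> L" "sum_list (map a w) = a h" "sum_list (map b w) = b h"
      "\<bar>s h - (sum_list (map s w) + area a b w)\<bar> \<le> N" for h w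
  proof -
    have w: "set w \<subseteq> letters G A" using that(2) by (simp add: L_def)
    have "wl h \<le> wl (wval w) + B"
      using that coords_wval[OF w] wval_closed[OF w]
      by (intro B[rule_format]) (simp_all del: abs_le_iff)
    also have "wl (wval w) \<le> length w"
      by (rule word_length_le[OF w])
    finally show ?thesis by simp
  qed
  \<comment> \<open>A word over the right point of the plane is as good as a word for \<open>h\<close> if its letter sum of
    \<open>s\<close> plus some attainable area \<open>t\<close> is close to \<open>s h\<close>.\<close>
  have permuted: "wl h \<le> length w + B"
    if h: "h \<in> carrier G" and w: "set w \<subseteq> L" "sum_list (map a w) = a h" "sum_list (map b w) = b h"
      and t: "\<bar>t\<bar> \<le> \<bar>area a b w\<bar>" "\<bar>s h - (sum_list (map s w) + t)\<bar> \<le> N - 2 * K" for h w t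
  proof -
    obtain w' where w': "mset w' = mset w" "\<bar>area a b w' - t\<bar> \<le> 2 * K"
      using permute_to_area[OF w(1) K K0 t(1)] by blast
    have "wl h \<le> length w' + B"
    proof (rule near[OF h])
      show "set w' \<subseteq> L" using w(1) mset_eq_setD[OF w'(1)] by simp
      show "\<bar>s h - (sum_list (map s w') + area a b w')\<bar> \<le> N"
        using w'(2) t(2) sum_list_map_mset_eq[OF w'(1), of s] by linarith
    qed (use w sum_list_map_mset_eq[OF w'(1)] in simp_all)
    then show ?thesis using mset_eq_length[OF w'(1)] by simp
  qed
  show ?thesis
  proof (intro exI ballI impI)
    fix h g1 g2
    assume h: "h \<in> carrier G" and g: "g1 \<in> carrier G" "g2 \<in> carrier G"
      and asm: "a g1 = a h \<and> a g2 = a h \<and> b g1 = b h \<and> b g2 = b h \<and> s g2 \<le> s h \<and> s h \<le> s g1"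
    then have ab: "a g1 = a h" "a g2 = a h" "b g1 = b h" "b g2 = b h"
      and s: "s g2 \<le> s h" "s h \<le> s g1" by auto
    define n where "n = max (wl g1) (wl g2)"
    have n: "wl g1 \<le> n" "wl g2 \<le> n" by (auto simp: n_def)
    obtain w1 where w1: "set w1 \<subseteq> L" "wval w1 = g1" "length w1 = wl g1"
      using geodesic[OF g(1)] unfolding L_def .
    obtain w2 where w2: "set w2 \<subseteq> L" "wval w2 = g2" "length w2 = wl g2"
      using geodesic[OF g(2)] unfolding L_def .
    note c1 = coords_wval[OF w1(1)[unfolded L_def], unfolded w1(2) ab]
    note c2 = coords_wval[OF w2(1)[unfolded L_def], unfolded w2(2) ab]
    define S1 where "S1 = sum_list (map s w1)"
    define S2 where "S2 = sum_list (map s w2)"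
    \<comment> \<open>Permuting \<open>w1\<close> reaches heights from \<open>S1 - \<bar>area\<bar>\<close> to \<open>S1 + \<bar>area\<bar>\<close>, an interval whose upper end
      is at least \<open>s g1\<close>. So if \<open>s h\<close> is not in it, then \<open>s h\<close> lies below its centre \<open>S1\<close>;
      dually for \<open>w2\<close>.\<close>
    consider "\<bar>s h - S1\<bar> \<le> \<bar>area a b w1\<bar>" | "\<bar>s h - S2\<bar> \<le> \<bar>area a b w2\<bar>" | "S2 < s h" "s h < S1"
    proof -
      have "s h \<le> S1 + \<bar>area a b w1\<bar>" "S2 - \<bar>area a b w2\<bar> \<le> s h"
        using s c1(3) c2(3) abs_ge_self[of "area a b w1"] abs_ge_minus_self[of "area a b w2"]
        unfolding S1_def S2_def by linarith+
      then show ?thesis using that by linarith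
    qed
    then have "wl h \<le> n + (m + B)"
    proof cases
      case 1
      then have "wl h \<le> length w1 + B"
        by (rule permuted[OF h w1(1), rotated 2]) (use c1 N in \<open>auto simp: S1_def\<close>)
      then show ?thesis using w1(3) n by simp
    next
      case 2
      then have "wl h \<le> length w2 + B"
        by (rule permuted[OF h w2(1), rotated 2]) (use c2 N in \<open>auto simp: S2_def\<close>)
      then show ?thesis using w2(3) n by simp
    next
      case 3
      \<comment> \<open>The weights express \<open>s h\<close> as an average: \<open>p * S1 + r * S2 = (p + r) * s h\<close>.\<close>
      define p where "p = nat (s h - S2)"
      define r where "r = nat (S1 - s h)"
      have pr: "int p = s h - S2" "int r = S1 - s h" "0 < p + r"
        using 3 by (auto simp: p_def r_def)
      obtain w where w: "set w \<subseteq> L" "length w \<le> n" and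
        mix: "\<forall>f. \<bar>int p * sum_list (map f w1) + int r * sum_list (map f w2)
          - int (p + r) * sum_list (map f w)\<bar> \<le> int (p + r) * (\<Sum>u\<in>L. \<bar>f u\<bar>)"
        using rounded_mixture[OF finL w1(1) w2(1) pr(3), of n] w1(3) w2(3) n by auto
      have close: "\<bar>x - sum_list (map f w)\<bar> \<le> E"
        if "int p * sum_list (map f w1) + int r * sum_list (map f w2) = int (p + r) * x"
          "(\<Sum>u\<in>L. \<bar>f u\<bar>) \<le> E" for f x
      proof -
        have "int (p + r) * \<bar>x - sum_list (map f w)\<bar> \<le> int (p + r) * (\<Sum>u\<in>L. \<bar>f u\<bar>)"
          using mix[rule_format, of f] unfolding that(1) by (simp only: right_diff_distrib[symmetric] abs_mult abs_of_nat)
        then show ?thesis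
          using pr(3) that(2) by (simp only: mult_le_cancel_left_pos of_nat_0_less_iff)
      qed
      have ea: "\<bar>a h - sum_list (map a w)\<bar> \<le> E"
        by (rule close[OF _ E(1)]) (simp add: c1(1)[symmetric] c2(1)[symmetric] algebra_simps)
      have eb: "\<bar>b h - sum_list (map b w)\<bar> \<le> E"
        by (rule close[OF _ E(2)]) (simp add: c1(2)[symmetric] c2(2)[symmetric] algebra_simps)
      have es: "\<bar>s h - sum_list (map s w)\<bar> \<le> E"
        by (rule close[OF _ E(3)])
          (simp add: S1_def[symmetric] S2_def[symmetric] pr algebra_simps)
      obtain c where c: "set c \<subseteq> L" "sum_list (map a c) = a h - sum_list (map a w)"
        "sum_list (map b c) = b h - sum_list (map b w)" "length c \<le> m" "\<bar>sum_list (map s c)\<bar> \<le> S"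
        using corr[rule_format, OF ea eb] by blast
      \<comment> \<open>The height is already correct up to \<open>E + S\<close> without area, so the area is brought near zero.\<close>
      have "wl h \<le> length (w @ c) + B"
        by (rule permuted[OF h, of _ 0]) (use w c es in \<open>auto simp: N_def\<close>)
      then show ?thesis using w(2) c(4) by simp
    qed
    then show "wl h \<le> max (wl g1) (wl g2) + (m + B)"
      by (simp add: n_def)
  qed
qed

text \<open>If \<open>h z\<^sup>k\<close> is shorter than \<open>h\<close> by more than \<open>C\<close> for some \<open>k\<close>, then no \<open>h z\<^bsup>-j\<^esup>\<close> is, since \<open>h\<close> lies
  between the two. So \<open>h\<close> can escape upwards or downwards.\<close>

lemma retreat_depth_bounded:
  assumes z: "z \<in> carrier G" "a z = 0" "b z = 0" "0 < s z"
  shows "\<exists>r::nat. \<forall>h\<in>carrier G. retreat_depth G A h \<le> enat r"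
proof -
  obtain C where C: "\<forall>h\<in>carrier G. \<forall>g1\<in>carrier G. \<forall>g2\<in>carrier G. a g1 = a h \<and> a g2 = a h \<and> b g1 = b h \<and> b g2 = b h
      \<and> s g2 \<le> s h \<and> s h \<le> s g1 \<longrightarrow> wl h \<le> max (wl g1) (wl g2) + C"
    using word_length_almost_quasiconvex by (elim exE) (rule that)
  have inj: "inj (\<lambda>k::nat. y [^] k)" if "y \<in> carrier G" "s y \<noteq> 0" for y
  proof (rule injI)
    fix i j :: nat assume "y [^] i = y [^] j"
    then have "int i * s y = int j * s y"
      using coords_nat_pow(3)[OF that(1)] by metis
    then show "i = j" using that(2) by simp
  qed
  have "retreat_depth G A h \<le> enat (C + (wl z + wl (inv z)) + 1)" if h: "h \<in> carrier G" for h
  proof (cases "\<forall>k::nat. wl h \<le> wl (h \<otimes> z [^] k) + C")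
    case True
    then have "retreat_depth G A h \<le> enat (C + wl z + 1)"
      using h z inj by (intro retreat_depth_le_along_powers) auto
    then show ?thesis by (rule order_trans) simp
  next
    case False
    then obtain k :: nat where k: "wl (h \<otimes> z [^] k) + C < wl h" by (auto simp: not_le)
    have "wl h \<le> wl (h \<otimes> inv z [^] j) + C" for j :: nat
    proof (rule ccontr)
      assume "\<not> wl h \<le> wl (h \<otimes> inv z [^] j) + C"
      then have j: "wl (h \<otimes> inv z [^] j) + C < wl h" by simp
      have "wl h \<le> max (wl (h \<otimes> z [^] k)) (wl (h \<otimes> inv z [^] j)) + C"
        by (rule C[rule_format, of h "h \<otimes> z [^] k" "h \<otimes> inv z [^] j"])
          (use h z in \<open>simp_all add: a_mult b_mult s_mult coords_nat_pow coords_inv\<close>)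
      then show False using j k by simp
    qed
    then have "retreat_depth G A h \<le> enat (C + wl (inv z) + 1)"
      using h z inj by (intro retreat_depth_le_along_powers) (auto simp: coords_inv)
    then show ?thesis by (rule order_trans) simp
  qed
  then show ?thesis by blast
qed

end

section \<open>Commutation relations in a group\<close>

context group
begin

text \<open>Conjugation is an automorphism.\<close>

lemma conj_int_pow:
  assumes "g \<in> carrier G" "y \<in> carrier G"
  shows "g \<otimes> y [^] (i::int) \<otimes> inv g = (g \<otimes> y \<otimes> inv g) [^] i"
proof -
  have "(\<lambda>u. g \<otimes> u \<otimes> inv g) \<in> hom G G"
    using assms by (auto simp: hom_def m_assoc inv_solve_left)
  from hom_int_pow[OF this assms(2) is_group is_group] show ?thesis .
qed

lemma int_pow_commutes:
  assumes "g \<in> carrier G" "y \<in> carrier G" "g \<otimes> y = y \<otimes> g"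
  shows "g \<otimes> y [^] (i::int) = y [^] i \<otimes> g"
proof -
  have "g \<otimes> y [^] i \<otimes> inv g = y [^] i"
    using conj_int_pow[OF assms(1,2)] assms by (simp add: m_assoc)
  then show ?thesis
    using assms by (metis inv_solve_right' int_pow_closed m_closed)
qed

lemma int_pow_commutes_mod_central:
  assumes c: "g \<in> carrier G" "y \<in> carrier G" "z \<in> carrier G"
    and gy: "g \<otimes> y = y \<otimes> z \<otimes> g" and yz: "y \<otimes> z = z \<otimes> y" and gz: "g \<otimes> z = z \<otimes> g"
  shows "g \<otimes> y [^] (i::int) = y [^] i \<otimes> (g \<otimes> z [^] i)"
proof -
  have "g \<otimes> y \<otimes> inv g = y \<otimes> z"
    using c by (simp add: gy m_assoc)
  then have "g \<otimes> y [^] i \<otimes> inv g = y [^] i \<otimes> z [^] i"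
    using conj_int_pow[OF c(1,2)] int_pow_mult_distrib[OF yz c(2,3)] by simp
  then have "g \<otimes> y [^] i = y [^] i \<otimes> z [^] i \<otimes> g"
    using c by (metis inv_solve_right' int_pow_closed m_closed)
  then show ?thesis
    using c int_pow_commutes[OF c(1,3) gz] by (simp add: m_assoc)
qed

lemma commutator_one_iff:
  assumes "g \<in> carrier G" "h \<in> carrier G"
  shows "g \<otimes> h \<otimes> inv g \<otimes> inv h = \<one> \<longleftrightarrow> g \<otimes> h = h \<otimes> g"
proof -
  have "g \<otimes> h \<otimes> inv g \<otimes> inv h = g \<otimes> h \<otimes> inv (h \<otimes> g)"
    using assms by (simp add: inv_mult_group m_assoc)
  also have "\<dots> = \<one> \<longleftrightarrow> g \<otimes> h = h \<otimes> g"
    using assms by (metis inv_solve_right' l_one m_closed one_closed)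
  finally show ?thesis .
qed

text \<open>Moving \<open>x\<^sup>e\<close> past \<open>y\<^sup>j\<close> costs \<open>z\<^bsup>e j\<^esup>\<close>. The cases \<open>e = 1\<close> and \<open>e = -1\<close>
  are those of the letters \<open>x\<close> and \<open>inv x\<close>.\<close>

lemma left_mult_normal_form:
  assumes c: "g \<in> carrier G" "x \<in> carrier G" "y \<in> carrier G" "z \<in> carrier G"
    and gx: "g = x [^] (e::int)" and gy: "g \<otimes> y = y \<otimes> z [^] e \<otimes> g"
    and xz: "x \<otimes> z = z \<otimes> x" and yz: "y \<otimes> z = z \<otimes> y"
  shows "g \<otimes> (y [^] (j::int) \<otimes> (x [^] (i::int) \<otimes> z [^] (k::int)))
    = y [^] j \<otimes> (x [^] (e + i) \<otimes> z [^] (e * j + k))"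
proof -
  have x_ze: "x \<otimes> z [^] n = z [^] n \<otimes> x" and y_ze: "y \<otimes> z [^] n = z [^] n \<otimes> y" for n :: int
    using int_pow_commutes c xz yz by auto
  have xn_zn: "z [^] n \<otimes> x [^] m = x [^] m \<otimes> z [^] n" for n m :: int
    using int_pow_commutes[of "z [^] n" x m] x_ze c by simp
  have "g \<otimes> y [^] j = y [^] j \<otimes> (g \<otimes> (z [^] e) [^] j)"
    using c gy y_ze[of e] xn_zn[of e e] gx by (intro int_pow_commutes_mod_central) auto
  then have "g \<otimes> (y [^] j \<otimes> (x [^] i \<otimes> z [^] k))
      = y [^] j \<otimes> (g \<otimes> (z [^] (e * j) \<otimes> (x [^] i \<otimes> z [^] k)))"
    using c by (simp add: m_assoc[symmetric] int_pow_pow)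
  also have "z [^] (e * j) \<otimes> (x [^] i \<otimes> z [^] k) = x [^] i \<otimes> z [^] (e * j + k)"
    using c xn_zn[of "e * j" i] by (simp add: m_assoc[symmetric] int_pow_mult)
  also have "g \<otimes> (x [^] i \<otimes> z [^] (e * j + k)) = x [^] (e + i) \<otimes> z [^] (e * j + k)"
    using c gx by (simp add: m_assoc[symmetric] int_pow_mult)
  finally show ?thesis .
qed

lemma inv_commutes_mod_central:
  assumes c: "x \<in> carrier G" "y \<in> carrier G" "z \<in> carrier G"
    and xy: "x \<otimes> y = y \<otimes> z \<otimes> x" and xz: "x \<otimes> z = z \<otimes> x"
  shows "inv x \<otimes> y = y \<otimes> inv z \<otimes> inv x"
proof -
  have cancel: "x \<otimes> (inv x \<otimes> inv z) = inv z"
    using c by (simp add: m_assoc[symmetric])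
  have "x \<otimes> (y \<otimes> inv z \<otimes> inv x) = (x \<otimes> y) \<otimes> (inv z \<otimes> inv x)"
    using c by (simp add: m_assoc)
  also have "inv z \<otimes> inv x = inv x \<otimes> inv z"
    using c xz by (simp add: inv_mult_group[symmetric])
  also have "(x \<otimes> y) \<otimes> (inv x \<otimes> inv z) = y"
    using c cancel unfolding xy by (simp add: m_assoc)
  finally show ?thesis
    using c by (metis inv_solve_left inv_closed m_closed)
qed

end

section \<open>Coordinates on the presented Heisenberg group\<close>

definition heisenberg_relators :: "heisenberg_gen gword set" where
  "heisenberg_relators =
    (let x = [(Gen_x, True)]; y = [(Gen_y, True)]
     in {comm_gword x (comm_gword x y), comm_gword y (comm_gword x y)})"

lemma heisenberg_eq: "heisenberg = presented_group heisenberg_relators"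
  by (simp add: heisenberg_def heisenberg_relators_def Let_def)

abbreviation word_class :: "heisenberg_gen gword \<Rightarrow> heisenberg_gen gword set" where
  "word_class w \<equiv> pres_cong heisenberg_relators `` {w}"

interpretation heis: group heisenberg
  unfolding heisenberg_eq by (rule group_presented_group)

lemma carrier_heisenberg: "carrier heisenberg = range word_class"
  by (auto simp: heisenberg_eq presented_group_def quotient_def)

lemma word_class_closed: "word_class w \<in> carrier heisenberg"
  by (simp add: carrier_heisenberg)

lemma one_heisenberg: "\<one>\<^bsub>heisenberg\<^esub> = word_class []"
  by (simp add: heisenberg_eq presented_group_def)

lemma word_class_mult: "word_class u \<otimes>\<^bsub>heisenberg\<^esub> word_class v = word_class (u @ v)"
  unfolding heisenberg_eq by (rule presented_group_mult)

lemma word_class_eq_iff: "word_class u = word_class v \<longleftrightarrow> (u, v) \<in> pres_cong heisenberg_relators"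
  using eq_equiv_class_iff[OF equiv_pres_cong] by auto

lemma word_class_inv: "inv\<^bsub>heisenberg\<^esub> (word_class w) = word_class (inv_gword w)"
proof (rule heis.inv_equality)
  show "word_class (inv_gword w) \<otimes>\<^bsub>heisenberg\<^esub> word_class w = \<one>\<^bsub>heisenberg\<^esub>"
    unfolding word_class_mult one_heisenberg word_class_eq_iff by (rule inv_gword_cong)
qed (simp_all add: word_class_closed)

fun x_sign :: "heisenberg_gen \<times> bool \<Rightarrow> int" where
  "x_sign (Gen_x, e) = (if e then 1 else -1)"
| "x_sign (Gen_y, e) = 0"

fun y_sign :: "heisenberg_gen \<times> bool \<Rightarrow> int" where
  "y_sign (Gen_x, e) = 0"
| "y_sign (Gen_y, e) = (if e then 1 else -1)"

lemma signs_cancel: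
  "x_sign (g, \<not> e) = - x_sign (g, e)" "y_sign (g, \<not> e) = - y_sign (g, e)"
  by (cases g; simp)+

text \<open>The relators have zero exponent sums, and their area vanishes since the commutator word has zero
  exponent sums as well, so that it commutes with everything as far as area is concerned.\<close>

lemma pres_cong_invariants:
  assumes "(u, v) \<in> pres_cong heisenberg_relators"
  shows "sum_list (map x_sign u) = sum_list (map x_sign v)
    \<and> sum_list (map y_sign u) = sum_list (map y_sign v)
    \<and> area x_sign y_sign u = area x_sign y_sign v"
  using assms
proof induction
  case (cancel g e)
  show ?case by (simp add: signs_cancel)
next
  case (relator r)
  then show ?case
    by (auto simp: heisenberg_relators_def Let_def comm_gword_def inv_gword_def)
next
  case (append u u' v v')
  then show ?case by (simp add: area_append)
qed auto

text \<open>The coordinates of a group element are the exponent sums and the area of any word that represents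
  it; \<open>pres_cong_invariants\<close> makes the choice of the word irrelevant.\<close>

definition x_coord :: "heisenberg_gen gword set \<Rightarrow> int" where
  "x_coord C = sum_list (map x_sign (SOME w. w \<in> C))"

definition y_coord :: "heisenberg_gen gword set \<Rightarrow> int" where
  "y_coord C = sum_list (map y_sign (SOME w. w \<in> C))"

definition area_coord :: "heisenberg_gen gword set \<Rightarrow> int" where
  "area_coord C = area x_sign y_sign (SOME w. w \<in> C)"

lemma coords_word_class:
  "x_coord (word_class w) = sum_list (map x_sign w)"
  "y_coord (word_class w) = sum_list (map y_sign w)"
  "area_coord (word_class w) = area x_sign y_sign w"
proof -
  have "w \<in> word_class w" by (simp add: pres_cong.refl)
  then have "(SOME u. u \<in> word_class w) \<in> word_class w" by (rule someI)
  then have "(w, SOME u. u \<in> word_class w) \<in> pres_cong heisenberg_relators" by simp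
  from pres_cong_invariants[OF this]
  show "x_coord (word_class w) = sum_list (map x_sign w)"
    "y_coord (word_class w) = sum_list (map y_sign w)"
    "area_coord (word_class w) = area x_sign y_sign w"
    by (simp_all add: x_coord_def y_coord_def area_coord_def)
qed

interpretation heis: symplectic_coordinates heisenberg x_coord y_coord area_coord
  by unfold_locales (auto simp: carrier_heisenberg word_class_mult coords_word_class area_append)

definition X where "X = word_class [(Gen_x, True)]"
definition Y where "Y = word_class [(Gen_y, True)]"
definition Z where "Z = word_class (comm_gword [(Gen_x, True)] [(Gen_y, True)])"

lemma XYZ_closed [simp]:
  "X \<in> carrier heisenberg" "Y \<in> carrier heisenberg" "Z \<in> carrier heisenberg"
  by (simp_all add: X_def Y_def Z_def word_class_closed)

lemma coords_XYZ:
  "x_coord X = 1" "y_coord X = 0" "area_coord X = 0"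
  "x_coord Y = 0" "y_coord Y = 1" "area_coord Y = 0"
  "x_coord Z = 0" "y_coord Z = 0" "area_coord Z = 2"
  by (simp_all add: X_def Y_def Z_def coords_word_class comm_gword_def inv_gword_def)

lemma word_class_comm_gword:
  "word_class (comm_gword u v) = word_class u \<otimes>\<^bsub>heisenberg\<^esub> word_class v
    \<otimes>\<^bsub>heisenberg\<^esub> inv\<^bsub>heisenberg\<^esub> (word_class u) \<otimes>\<^bsub>heisenberg\<^esub> inv\<^bsub>heisenberg\<^esub> (word_class v)"
  by (simp add: comm_gword_def word_class_inv word_class_mult)

lemma XYZ_relations:
  "X \<otimes>\<^bsub>heisenberg\<^esub> Z = Z \<otimes>\<^bsub>heisenberg\<^esub> X"
  "Y \<otimes>\<^bsub>heisenberg\<^esub> Z = Z \<otimes>\<^bsub>heisenberg\<^esub> Y"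
  "X \<otimes>\<^bsub>heisenberg\<^esub> Y = Y \<otimes>\<^bsub>heisenberg\<^esub> Z \<otimes>\<^bsub>heisenberg\<^esub> X"
proof -
  have commute: "word_class u \<otimes>\<^bsub>heisenberg\<^esub> word_class v = word_class v \<otimes>\<^bsub>heisenberg\<^esub> word_class u"
    if "comm_gword u v \<in> heisenberg_relators" for u v
  proof -
    have "word_class (comm_gword u v) = \<one>\<^bsub>heisenberg\<^esub>"
      unfolding one_heisenberg word_class_eq_iff using that by (rule pres_cong.relator)
    then show ?thesis
      unfolding word_class_comm_gword heis.commutator_one_iff[OF word_class_closed word_class_closed] .
  qed
  show "X \<otimes>\<^bsub>heisenberg\<^esub> Z = Z \<otimes>\<^bsub>heisenberg\<^esub> X"
    unfolding X_def Z_def by (rule commute) (simp add: heisenberg_relators_def Let_def)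
  show YZ: "Y \<otimes>\<^bsub>heisenberg\<^esub> Z = Z \<otimes>\<^bsub>heisenberg\<^esub> Y"
    unfolding Y_def Z_def by (rule commute) (simp add: heisenberg_relators_def Let_def)
  have "Z = X \<otimes>\<^bsub>heisenberg\<^esub> Y \<otimes>\<^bsub>heisenberg\<^esub> inv\<^bsub>heisenberg\<^esub> (Y \<otimes>\<^bsub>heisenberg\<^esub> X)"
    by (simp add: X_def Y_def Z_def word_class_comm_gword heis.inv_mult_group heis.m_assoc word_class_closed)
  then have "X \<otimes>\<^bsub>heisenberg\<^esub> Y = Z \<otimes>\<^bsub>heisenberg\<^esub> (Y \<otimes>\<^bsub>heisenberg\<^esub> X)"
    by (simp add: heis.inv_solve_right)
  also have "\<dots> = Y \<otimes>\<^bsub>heisenberg\<^esub> Z \<otimes>\<^bsub>heisenberg\<^esub> X"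
    by (simp add: YZ heis.m_assoc[symmetric])
  finally show "X \<otimes>\<^bsub>heisenberg\<^esub> Y = Y \<otimes>\<^bsub>heisenberg\<^esub> Z \<otimes>\<^bsub>heisenberg\<^esub> X" .
qed

definition normal_form :: "int \<Rightarrow> int \<Rightarrow> int \<Rightarrow> heisenberg_gen gword set" where
  "normal_form j i k = Y [^]\<^bsub>heisenberg\<^esub> j \<otimes>\<^bsub>heisenberg\<^esub>
    (X [^]\<^bsub>heisenberg\<^esub> i \<otimes>\<^bsub>heisenberg\<^esub> Z [^]\<^bsub>heisenberg\<^esub> k)"

text \<open>The three coordinates determine the exponents, which is why they separate the elements once every
  element has a normal form.\<close>

lemma coords_normal_form:
  "x_coord (normal_form j i k) = i" "y_coord (normal_form j i k) = j"
  "area_coord (normal_form j i k) = 2 * k - i * j"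
  by (simp_all add: normal_form_def heis.a_mult heis.b_mult heis.s_mult heis.coords_int_pow
      coords_XYZ)

lemma word_class_letter:
  "word_class [(Gen_x, e)] = X [^]\<^bsub>heisenberg\<^esub> (if e then 1 else -1 :: int)"
  "word_class [(Gen_y, e)] = Y [^]\<^bsub>heisenberg\<^esub> (if e then 1 else -1 :: int)"
  by (simp_all add: heis.int_pow_neg X_def Y_def word_class_closed word_class_inv inv_gword_def)

text \<open>The letters are multiplied on from the left one at a time; each only shifts the three exponents,
  since the relators make \<open>Z\<close> central.\<close>

lemma exists_normal_form: "\<exists>j i k. word_class w = normal_form j i k"
proof (induction w)
  case Nil
  have "word_class [] = normal_form 0 0 0"
    by (simp add: normal_form_def one_heisenberg[symmetric])
  then show ?case by blast
next
  case (Cons l w)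
  then obtain j i k where w: "word_class w = normal_form j i k" by blast
  obtain g e where l: "l = (g, e)" by force
  have step: "word_class (l # w) = word_class [(g, e)] \<otimes>\<^bsub>heisenberg\<^esub> normal_form j i k"
    by (simp add: word_class_mult w[symmetric] l)
  define d :: int where "d = (if e then 1 else -1)"
  show ?case
  proof (cases g)
    case Gen_x
    have "X [^]\<^bsub>heisenberg\<^esub> d \<otimes>\<^bsub>heisenberg\<^esub> Y
        = Y \<otimes>\<^bsub>heisenberg\<^esub> Z [^]\<^bsub>heisenberg\<^esub> d \<otimes>\<^bsub>heisenberg\<^esub> X [^]\<^bsub>heisenberg\<^esub> d"
      using XYZ_relations heis.inv_commutes_mod_central[of X Y Z]
      by (simp add: d_def heis.int_pow_neg)
    from heis.left_mult_normal_form[OF _ _ _ _ HOL.refl this XYZ_relations(1,2)]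
    have "word_class (l # w) = normal_form j (d + i) (d * j + k)"
      by (simp add: step Gen_x word_class_letter(1)[of e, folded d_def] normal_form_def)
    then show ?thesis by blast
  next
    case Gen_y
    have "word_class (l # w) = normal_form (d + j) i k"
      by (simp add: step Gen_y word_class_letter(2)[of e, folded d_def] normal_form_def
          heis.int_pow_mult heis.m_assoc)
    then show ?thesis by blast
  qed
qed

lemma heisenberg_coords_inj:
  assumes "g \<in> carrier heisenberg" "h \<in> carrier heisenberg"
    and "x_coord g = x_coord h" "y_coord g = y_coord h" "area_coord g = area_coord h"
  shows "g = h"
proof -
  obtain u where "g = word_class u"
    using assms(1) unfolding carrier_heisenberg by (rule imageE)
  then obtain j i k where g: "g = normal_form j i k"
    using exists_normal_form[of u] by auto
  obtain v where "h = word_class v"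
    using assms(2) unfolding carrier_heisenberg by (rule imageE)
  then obtain j' i' k' where h: "h = normal_form j' i' k'"
    using exists_normal_form[of v] by auto
  show ?thesis
    using assms(3-5) unfolding g h coords_normal_form by simp
qed

section \<open>Bounded retreat depth\<close>

theorem proposition2:
  fixes A :: "heisenberg_gen gword set set"
  assumes "finite A"
    and "A \<subseteq> carrier heisenberg"
    and "generate heisenberg A = carrier heisenberg"
  shows "\<exists>r::nat. \<forall>h \<in> carrier heisenberg. retreat_depth heisenberg A h \<le> enat r"
proof -
  interpret fin_gen_heisenberg heisenberg x_coord y_coord area_coord A
  proof unfold_locales
    show "\<exists>g\<in>carrier heisenberg. x_coord g = i \<and> y_coord g = j" for i j
      using coords_normal_form(1,2)[of j i 0]
      by (intro bexI[of _ "normal_form j i 0"]) (auto simp: normal_form_def)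
  qed (use assms heisenberg_coords_inj in auto)
  show ?thesis
    by (rule retreat_depth_bounded[of Z]) (simp_all add: coords_XYZ)
qed

end
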